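(* Let $T=\{x_1,\dots,x_n\}$ be a finite training set of independent uncertain objects with labels in $\{c,c'\}$, let $k\ge1$ be an integer such that each class contains at least $k$ objects of $T$, and let $q$ be a certain test object. Let $T^q=\{x_i\in T: mindist(q,x_i)\le R^q_{max}\}$, and for $e\in\{c,c'\}$ let $D_q(e)$ be the random variable whose outcome is the distance between $q$ and its $k$-th nearest neighbor in the set $T^q$ having class label $e$. Then $$\Pr\big(D(q,c)<D(q,c')\big)=\Pr\big(D_q(c)<D_q(c')\big).$$
   Context: $(\mathbb{D},d)$ is a metric space (e.g. $\mathbb{R}^d$ with the Euclidean distance) equipped with a reference measure (e.g. Lebesgue measure). A certain object is an element of $\mathbb{D}$. An uncertain object $x$ is a random variable with values in $\mathbb{D}$ with probability density function $f^x$. The training objects are independent, and each carries a deterministic label. For each $x_i$ the distance $d(q,x_i)$ is a continuous real random variable, i.e. it has a density. Each uncertain object $x$ is associated with a bounded (nonempty) region $\mathrm{SUP}(x)\subseteq\mathbb{D}$ (e.g. a ball or a hypercube) with $\Pr(x\notin \mathrm{SUP}(x))=0$. For a certain object $q$, $mindist(q,x)=\inf\{d(q,w):w\in \mathrm{SUP}(x)\}$ and $maxdist(q,x)=\sup\{d(q,w):w\in \mathrm{SUP}(x)\}$. $T_c$ is the set of training objects with label $c$. $D(q,c)$ is the random variable equal to the distance between $q$ and its $k$-th nearest object among the objects of $T_c$; similarly for $c'$. $R^q_c=\min\{R\ge0: |\{x\in T_c: maxdist(q,x)\le R\}|\ge k\}$, and similarly $R^q_{c'}$. $R^q_{max}=\min\{R^q_c,R^q_{c'}\}$.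 Convention: if $T^q$ contains fewer than $k$ objects with label $e$, then $D_q(e)=+\infty$. *)

theory Defs
  imports "HOL-Probability.Probability"
begin

text \<open>
  Objects are identified by indices \<open>i :: 'i\<close>: \<open>X i\<close> is the random variable of object \<open>i\<close>,
  \<open>A i\<close> its bounded region, and \<open>lab i\<close> its label.
\<close>

definition mindist :: "'a::metric_space \<Rightarrow> 'a set \<Rightarrow> real" where
  "mindist q S = (INF w\<in>S. dist q w)"

definition maxdist :: "'a::metric_space \<Rightarrow> 'a set \<Rightarrow> real" where
  "maxdist q S = (SUP w\<in>S. dist q w)"

definition with_label :: "('i \<Rightarrow> 'l) \<Rightarrow> 'l \<Rightarrow> 'i set \<Rightarrow> 'i set" where
  "with_label lab e T = {i \<in> T. lab i = e}"

text \<open>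
  For an outcome \<open>\<omega>\<close>, the distances from \<open>q\<close> to the objects in the finite set \<open>S\<close> are listed in
  increasing order (with multiplicity, so that ties do not matter); the \<open>k\<close>-th entry has
  list position \<open>k - 1\<close>.
\<close>

definition kth_nn_dist ::
    "nat \<Rightarrow> 'a::metric_space \<Rightarrow> ('i \<Rightarrow> '\<omega> \<Rightarrow> 'a) \<Rightarrow> 'i set \<Rightarrow> '\<omega> \<Rightarrow> ereal" where
  "kth_nn_dist k q X S \<omega> =
     (if card S < k then \<infinity>
      else ereal (sorted_list_of_multiset {# dist q (X i \<omega>). i \<in># mset_set S #} ! (k - 1)))"

definition R_class :: "nat \<Rightarrow> 'a::metric_space \<Rightarrow> ('i \<Rightarrow> 'a set) \<Rightarrow> 'i set \<Rightarrow> real" where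
  "R_class k q A S = (LEAST R. 0 \<le> R \<and> k \<le> card {i \<in> S. maxdist q (A i) \<le> R})"

definition R_max ::
    "nat \<Rightarrow> 'a::metric_space \<Rightarrow> ('i \<Rightarrow> 'a set) \<Rightarrow> ('i \<Rightarrow> 'l) \<Rightarrow> 'l \<Rightarrow> 'l \<Rightarrow> 'i set \<Rightarrow> real" where
  "R_max k q A lab c c' T =
     min (R_class k q A (with_label lab c T)) (R_class k q A (with_label lab c' T))"

definition near_objects ::
    "nat \<Rightarrow> 'a::metric_space \<Rightarrow> ('i \<Rightarrow> 'a set) \<Rightarrow> ('i \<Rightarrow> 'l) \<Rightarrow> 'l \<Rightarrow> 'l \<Rightarrow> 'i set \<Rightarrow> 'i set" where
  "near_objects k q A lab c c' T = {i \<in> T. mindist q (A i) \<le> R_max k q A lab c c' T}"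

end

theory Submission
  imports Defs
begin

text \<open>
  Almost surely every object lies in its region, so \<open>mindist \<le> d(q, x\<^sub>i) \<le> maxdist\<close>. Hence discarded
  objects are farther than \<open>R = R_max\<close>, and every \<open>k\<close>-th nearest distance that is at most \<open>R\<close> is
  unaffected by discarding, while in general discarding can only increase it. Since the smaller of
  the two \<open>k\<close>-th nearest distances is at most \<open>R\<close>, the two events coincide almost surely.
\<close>

text \<open>In a sorted list the entries that are at most \<open>r\<close> form a prefix, so the
  filtered length is the first position whose entry exceeds \<open>r\<close>.\<close>

lemma sorted_nth_le_iff:
  fixes xs :: "'a::linorder list"
  assumes "sorted xs" "n < length xs"
  shows "xs ! n \<le> r \<longleftrightarrow> n < length (filter (\<lambda>x. x \<le> r) xs)"
  using assms
proof (induction xs arbitrary: n)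
  case (Cons x xs)
  show ?case
  proof (cases "x \<le> r")
    case True
    with Cons show ?thesis by (cases n) auto
  next
    case False
    with Cons.prems have "\<forall>y\<in>set (x # xs). \<not> y \<le> r" by auto
    then show ?thesis
      using Cons.prems(2) by (metis filter_False list.size(3) not_less_zero nth_mem)
  qed
qed simp

text \<open>This replaces the sorted list by a count of the objects in a closed ball around
  \<open>q\<close>, which is easier to compare between sets of objects. If \<open>S\<close> has
  fewer than \<open>k\<close> objects, the distance is infinite and the count cannot reach
  \<open>k\<close>.\<close>

lemma kth_nn_dist_le_iff:
  assumes "finite S" "k \<ge> 1"
  shows "kth_nn_dist k q X S \<omega> \<le> ereal r \<longleftrightarrow> k \<le> card {i \<in> S. dist q (X i \<omega>) \<le> r}"
proof (cases "card S < k")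
  case True
  moreover have "card {i \<in> S. dist q (X i \<omega>) \<le> r} \<le> card S"
    using assms(1) by (intro card_mono) auto
  ultimately show ?thesis by (simp add: kth_nn_dist_def)
next
  case False
  define D where "D = {# dist q (X i \<omega>). i \<in># mset_set S #}"
  define xs where "xs = sorted_list_of_multiset D"
  have mset_xs: "mset xs = D" by (simp add: xs_def)
  then have "length xs = card S" by (metis D_def size_image_mset size_mset size_mset_set)
  with False assms(2) have "k - 1 < length xs" by simp
  moreover have "length (filter (\<lambda>x. x \<le> r) xs) = card {i \<in> S. dist q (X i \<omega>) \<le> r}"
  proof -
    have "length (filter (\<lambda>x. x \<le> r) xs) = size (filter_mset (\<lambda>x. x \<le> r) D)"
      by (metis mset_filter mset_xs size_mset)
    also have "\<dots> = card {i \<in> S. dist q (X i \<omega>) \<le> r}"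
      using assms(1) by (simp add: D_def filter_mset_image_mset)
    finally show ?thesis .
  qed
  \<comment> \<open>Positions start at 0; since \<open>k \<ge> 1\<close>, the condition
    \<open>k - 1 < n\<close> is the same as \<open>k \<le> n\<close>.\<close>
  ultimately have "xs ! (k - 1) \<le> r \<longleftrightarrow> k - 1 < card {i \<in> S. dist q (X i \<omega>) \<le> r}"
    by (simp add: sorted_nth_le_iff xs_def)
  with False assms(2) show ?thesis
    by (auto simp: kth_nn_dist_def xs_def D_def)
qed

text \<open>Every ball holds at least as many objects of the larger set, so \<open>k\<close> of them
  are reached no later.\<close>

lemma kth_nn_dist_antimono:
  assumes "S \<subseteq> S'" "finite S'" "k \<ge> 1"
  shows "kth_nn_dist k q X S' \<omega> \<le> kth_nn_dist k q X S \<omega>"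
proof (cases "kth_nn_dist k q X S \<omega>")
  case (real r)
  have "finite S" using assms finite_subset by blast
  with real assms(3) have "k \<le> card {i \<in> S. dist q (X i \<omega>) \<le> r}"
    by (simp flip: kth_nn_dist_le_iff)
  also have "\<dots> \<le> card {i \<in> S'. dist q (X i \<omega>) \<le> r}"
    using assms by (intro card_mono) auto
  finally show ?thesis
    using real assms by (simp add: kth_nn_dist_le_iff)
next
  case MInf
  then show ?thesis by (simp add: kth_nn_dist_def split: if_splits)
qed simp

text \<open>The \<open>k\<close>-th distance \<open>r\<close> in \<open>S'\<close> is at most
  \<open>R\<close>, and all removed objects lie beyond \<open>R\<close>. Hence the ball of radius
  \<open>r\<close> loses nothing and still holds \<open>k\<close> objects of
  \<open>S\<close>.\<close>

lemma kth_nn_dist_subset_eq: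
  assumes "S \<subseteq> S'" "finite S'" "k \<ge> 1"
    and far: "\<And>i. i \<in> S' - S \<Longrightarrow> R < dist q (X i \<omega>)"
    and le: "kth_nn_dist k q X S' \<omega> \<le> ereal R"
  shows "kth_nn_dist k q X S \<omega> = kth_nn_dist k q X S' \<omega>"
proof (rule antisym)
  obtain r where r: "kth_nn_dist k q X S' \<omega> = ereal r"
    using le by (auto simp: kth_nn_dist_def split: if_splits)
  have "finite S" using assms finite_subset by blast
  have "k \<le> card {i \<in> S'. dist q (X i \<omega>) \<le> r}"
    using r assms(2,3) by (simp flip: kth_nn_dist_le_iff)
  also have "{i \<in> S'. dist q (X i \<omega>) \<le> r} = {i \<in> S. dist q (X i \<omega>) \<le> r}"
    using far le r assms(1) by fastforce
  finally show "kth_nn_dist k q X S \<omega> \<le> kth_nn_dist k q X S' \<omega>"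
    using r assms(3) \<open>finite S\<close> by (simp add: kth_nn_dist_le_iff)
qed (use assms in \<open>simp add: kth_nn_dist_antimono\<close>)

lemma R_class_card:
  assumes "finite S" "k \<le> card S"
  shows "k \<le> card {i \<in> S. maxdist q (A i) \<le> R_class k q A S}"
proof -
  define P where "P R \<longleftrightarrow> 0 \<le> R \<and> k \<le> card {i \<in> S. maxdist q (A i) \<le> R}" for R
  \<comment> \<open>The least \<open>R\<close> exists because only \<open>0\<close> and the finitely many values of \<open>maxdist\<close> matter.\<close>
  define V where "V = insert 0 ((\<lambda>i. maxdist q (A i)) ` S)"
  have V: "finite V" "V \<noteq> {}" using assms by (auto simp: V_def)
  \<comment> \<open>Lowering \<open>R\<close> to the largest candidate in \<open>V\<close> not above
    it admits the same objects. Having \<open>0\<close> in \<open>V\<close> guarantees that such a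
    candidate exists and is nonnegative.\<close>
  have below: "\<exists>v\<in>V. P v \<and> v \<le> R" if "P R" for R
  proof -
    define W where "W = {v \<in> V. v \<le> R}"
    have W: "finite W" "0 \<in> W" using V that by (auto simp: W_def V_def P_def)
    then have "Max W \<in> W" by (intro Max_in) auto
    moreover have "{i \<in> S. maxdist q (A i) \<le> R} = {i \<in> S. maxdist q (A i) \<le> Max W}"
      using W \<open>Max W \<in> W\<close> by (force simp: W_def V_def intro!: Max_ge)
    ultimately show ?thesis
      using that W by (auto simp: W_def P_def intro!: Max_ge bexI[of _ "Max W"])
  qed
  have "{i \<in> S. maxdist q (A i) \<le> Max V} = S"
    using V by (auto simp: V_def)
  then have "P (Max V)"
    using V assms by (simp add: P_def V_def)
  with below have ne: "{v \<in> V. P v} \<noteq> {}" by blast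
  define m where "m = Min {v \<in> V. P v}"
  have m: "P m" "\<And>v. v \<in> V \<Longrightarrow> P v \<Longrightarrow> m \<le> v"
    using Min_in[of "{v \<in> V. P v}"] ne V(1) by (auto simp: m_def)
  have "(LEAST R. P R) = m"
    using m below by (intro Least_equality) (blast intro: order_trans)+
  then have "R_class k q A S = m" by (simp add: R_class_def P_def)
  with m(1) show ?thesis by (simp add: P_def)
qed

lemma mindist_le: "w \<in> S \<Longrightarrow> mindist q S \<le> dist q w"
  unfolding mindist_def by (rule cINF_lower) (auto intro!: bdd_belowI2[of _ 0])

lemma le_maxdist: "bounded S \<Longrightarrow> w \<in> S \<Longrightarrow> dist q w \<le> maxdist q S"
  unfolding maxdist_def
  by (rule cSUP_upper) (auto simp: bounded_any_center[where a = q] bdd_above_def)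

text \<open>At least \<open>k\<close> objects have their whole region within \<open>R_class\<close>
  of \<open>q\<close>, so their actual positions are within that distance too.\<close>

lemma kth_nn_dist_le_R_class:
  assumes "finite S" "1 \<le> k" "k \<le> card S"
    and "\<And>i. i \<in> S \<Longrightarrow> bounded (A i)" "\<And>i. i \<in> S \<Longrightarrow> X i \<omega> \<in> A i"
  shows "kth_nn_dist k q X S \<omega> \<le> ereal (R_class k q A S)"
proof -
  have "k \<le> card {i \<in> S. maxdist q (A i) \<le> R_class k q A S}"
    using assms by (intro R_class_card)
  also have "\<dots> \<le> card {i \<in> S. dist q (X i \<omega>) \<le> R_class k q A S}"
    using assms by (intro card_mono) (auto intro: order_trans[OF le_maxdist])
  finally show ?thesis
    using assms by (simp add: kth_nn_dist_le_iff)
qed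

text \<open>The deterministic core: a single outcome is fixed in which every object lies in its
  region. The argument splits by which class has the smaller distance, since that distance is at
  most \<open>R_max\<close> and survives the pruning.\<close>

lemma kth_nn_dist_near_objects_less_iff:
  fixes T :: "'i set" and lab :: "'i \<Rightarrow> 'l" and c c' :: 'l
  assumes "finite T" "1 \<le> k" "k \<le> card (with_label lab c T)" "k \<le> card (with_label lab c' T)"
    and bounded: "\<And>i. i \<in> T \<Longrightarrow> bounded (A i)" and inside: "\<And>i. i \<in> T \<Longrightarrow> X i \<omega> \<in> A i"
  shows "kth_nn_dist k q X (with_label lab c (near_objects k q A lab c c' T)) \<omega>
           < kth_nn_dist k q X (with_label lab c' (near_objects k q A lab c c' T)) \<omega>
     \<longleftrightarrow> kth_nn_dist k q X (with_label lab c T) \<omega> < kth_nn_dist k q X (with_label lab c' T) \<omega>"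
    (is "?Dq c < ?Dq c' \<longleftrightarrow> ?D c < ?D c'")
proof -
  have sub: "with_label lab e (near_objects k q A lab c c' T) \<subseteq> with_label lab e T" for e
    by (auto simp: with_label_def near_objects_def)
  have fin: "finite (with_label lab e T)" for e
    using assms(1) by (simp add: with_label_def)
  have ge: "?D e \<le> ?Dq e" for e
    using sub fin assms(2) by (rule kth_nn_dist_antimono)
  have eq: "?Dq e = ?D e" if "?D e \<le> ereal (R_max k q A lab c c' T)" for e
    using sub fin assms(2) _ that
  proof (rule kth_nn_dist_subset_eq)
    fix i
    assume "i \<in> with_label lab e T - with_label lab e (near_objects k q A lab c c' T)"
    then have "i \<in> T" "R_max k q A lab c c' T < mindist q (A i)"
      by (auto simp: with_label_def near_objects_def)
    then show "R_max k q A lab c c' T < dist q (X i \<omega>)"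
      using mindist_le[OF inside] by (blast intro: less_le_trans)
  qed
  have R: "?D e \<le> ereal (R_class k q A (with_label lab e T))" if "e \<in> {c, c'}" for e
    using assms that fin
    by (intro kth_nn_dist_le_R_class) (auto simp: with_label_def)
  have "min (?D c) (?D c') \<le> ereal (R_max k q A lab c c' T)"
    unfolding R_max_def ereal_min using R[of c] R[of c'] by (intro min.mono) auto
  then consider "?D c \<le> ereal (R_max k q A lab c c' T)" "?D c \<le> ?D c'"
    | "?D c' \<le> ereal (R_max k q A lab c c' T)" "?D c' \<le> ?D c"
    unfolding min_le_iff_disj by (meson linear order_trans)
  then show ?thesis
  proof cases
    case 1
    show ?thesis
    proof
      \<comment> \<open>Otherwise \<open>?D c = ?D c'\<close>. Then both distances are at most
        \<open>R_max\<close>, both survive the pruning, and the pruned distances would be equal as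
        well.\<close>
      assume "?Dq c < ?Dq c'"
      then show "?D c < ?D c'"
        by (metis 1 eq ge leD order_le_imp_less_or_eq order_trans)
    next
      assume "?D c < ?D c'"
      then show "?Dq c < ?Dq c'"
        using eq[OF 1(1)] ge[of c'] by (metis order_less_le_trans)
    qed
  next
    case 2
    \<comment> \<open>Here both strict inequalities fail:
      \<open>?Dq c' = ?D c' \<le> ?D c \<le> ?Dq c\<close>.\<close>
    then have "?Dq c' \<le> ?Dq c"
      using eq[of c'] ge[of c] by (metis order_trans)
    with 2(2) show ?thesis by (simp add: leD)
  qed
qed

text \<open>A strict inequality is witnessed by a rational threshold, so the event is a countable
  union of events built from sublevel sets, and these are described by counts.\<close>

lemma sets_kth_nn_dist_less:
  assumes "finite S" "finite S'" "1 \<le> k"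
    and [measurable]: "\<And>i. i \<in> S \<union> S' \<Longrightarrow> (\<lambda>\<omega>. dist q (X i \<omega>)) \<in> borel_measurable M"
  shows "{\<omega> \<in> space M. kth_nn_dist k q X S \<omega> < kth_nn_dist k q X S' \<omega>} \<in> sets M"
proof -
  have meas: "{\<omega> \<in> space M. kth_nn_dist k q X U \<omega> \<le> ereal r} \<in> sets M"
    if "U \<subseteq> S \<union> S'" for U r
  proof -
    have "finite U" using that assms finite_subset by blast
    have [measurable]: "(\<lambda>\<omega>. dist q (X i \<omega>)) \<in> borel_measurable M" if "i \<in> U" for i
      using that \<open>U \<subseteq> S \<union> S'\<close> assms(4) by blast
    \<comment> \<open>As a finite sum of indicators, the count is visibly measurable in the
      outcome.\<close>
    have "real (card {i \<in> U. dist q (X i \<omega>) \<le> r})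
        = (\<Sum>i\<in>U. if dist q (X i \<omega>) \<le> r then 1 else 0)" for \<omega>
      using \<open>finite U\<close> by (simp add: sum.If_cases Int_def)
    then have "kth_nn_dist k q X U \<omega> \<le> ereal r
        \<longleftrightarrow> real k \<le> (\<Sum>i\<in>U. if dist q (X i \<omega>) \<le> r then 1 else 0)" for \<omega>
      using kth_nn_dist_le_iff[OF \<open>finite U\<close> assms(3)] by (metis of_nat_le_iff)
    then show ?thesis by simp
  qed
  have iff: "a < b \<longleftrightarrow> (\<exists>r::rat. a \<le> ereal (real_of_rat r) \<and> \<not> b \<le> ereal (real_of_rat r))"
    for a b :: ereal
    by (metis ereal_dense3 less_imp_le not_le order_le_less_trans)
  have [measurable]: "Measurable.pred M (\<lambda>\<omega>. kth_nn_dist k q X U \<omega> \<le> ereal r)"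
    if "U = S \<or> U = S'" for U r
    using meas that by (auto simp: pred_def)
  show ?thesis
    unfolding iff by measurable
qed

theorem proposition3p3:
  fixes M :: "'\<omega> measure"
    and N :: "'a::metric_space measure"
    and T :: "'i set"
    and X :: "'i \<Rightarrow> '\<omega> \<Rightarrow> 'a"
    and f :: "'i \<Rightarrow> 'a \<Rightarrow> ennreal"
    and A :: "'i \<Rightarrow> 'a set"
    and lab :: "'i \<Rightarrow> 'l"
    and c c' :: 'l
    and k :: nat
    and q :: 'a
  assumes "prob_space M"
    and "sets N = sets borel"
    and "finite T"
    and "\<And>i. i \<in> T \<Longrightarrow> distributed M N (X i) (f i)"
    and "prob_space.indep_vars M (\<lambda>_. borel) X T"
    and "\<And>i. i \<in> T \<Longrightarrow> \<exists>g. distributed M lborel (\<lambda>\<omega>. dist q (X i \<omega>)) g"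
    and "\<And>i. i \<in> T \<Longrightarrow> A i \<noteq> {}"
    and "\<And>i. i \<in> T \<Longrightarrow> bounded (A i)"
    and "\<And>i. i \<in> T \<Longrightarrow> AE \<omega> in M. X i \<omega> \<in> A i"
    and "\<And>i. i \<in> T \<Longrightarrow> lab i \<in> {c, c'}"
    and "k \<ge> 1"
    and "k \<le> card (with_label lab c T)"
    and "k \<le> card (with_label lab c' T)"
  shows "\<P>(\<omega> in M. kth_nn_dist k q X (with_label lab c T) \<omega>
                   < kth_nn_dist k q X (with_label lab c' T) \<omega>)
       = \<P>(\<omega> in M. kth_nn_dist k q X (with_label lab c (near_objects k q A lab c c' T)) \<omega>
                   < kth_nn_dist k q X (with_label lab c' (near_objects k q A lab c c' T)) \<omega>)"
proof -
  interpret prob_space M by fact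
  let ?near = "near_objects k q A lab c c' T"
  have "AE \<omega> in M. \<forall>i\<in>T. X i \<omega> \<in> A i"
    using assms(3,9) by (simp add: AE_finite_all)
  then have AE: "AE \<omega> in M.
        kth_nn_dist k q X (with_label lab c T) \<omega> < kth_nn_dist k q X (with_label lab c' T) \<omega>
    \<longleftrightarrow> kth_nn_dist k q X (with_label lab c ?near) \<omega>
          < kth_nn_dist k q X (with_label lab c' ?near) \<omega>"
  proof eventually_elim
    case (elim \<omega>)
    then show ?case
      using assms(3,8,11-13) by (intro kth_nn_dist_near_objects_less_iff[symmetric]) auto
  qed
  \<comment> \<open>Almost sure equivalence gives equal probabilities once both events are
    measurable; \<open>U\<close> stands for \<open>T\<close> and for \<open>?near\<close>.\<close>
  have meas: "{\<omega> \<in> space M. kth_nn_dist k q X (with_label lab c U) \<omega>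
                  < kth_nn_dist k q X (with_label lab c' U) \<omega>} \<in> events" if "U \<subseteq> T" for U
  proof (rule sets_kth_nn_dist_less)
    show "finite (with_label lab c U)" "finite (with_label lab c' U)"
      using finite_subset[OF that assms(3)] by (auto simp: with_label_def)
    fix i assume "i \<in> with_label lab c U \<union> with_label lab c' U"
    with that have "i \<in> T" by (auto simp: with_label_def)
    then show "random_variable borel (\<lambda>\<omega>. dist q (X i \<omega>))"
      using assms(6) distributed_measurable by fastforce
  qed fact
  have "?near \<subseteq> T" by (auto simp: near_objects_def)
  with AE meas show ?thesis
    by (intro finite_measure_eq_AE) auto
qed

end
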